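(* Let $(X,E)$ be a finite graph (simple, unoriented, without loops). Let $\mathcal{M}_X$ be the Markov operator of the vertex lamplighter random walk on $X$ and, for each $\theta\in\{0,1\}^X$, let \[ M_\theta=\lambda_{\theta,1}P_{\theta,1}+\lambda_{\theta,2}P_{\theta,2}+\cdots+\lambda_{\theta,h(\theta)}P_{\theta,h(\theta)} \] be the spectral decomposition of $M_\theta$, that is, $\lambda_{\theta,1},\dots,\lambda_{\theta,h(\theta)}$ are the distinct nonzero eigenvalues of $M_\theta$ and $P_{\theta,j}$ is the orthogonal projection of $L(X)$ onto the eigenspace of $\lambda_{\theta,j}$. Then the spectral decomposition of the operator $\mathcal{M}_X$ is given by \[ \mathcal{M}_X=\sum_{\theta\in\{0,1\}^X}\sum_{j=1}^{h(\theta)}\lambda_{\theta,j}\big(\chi_\theta\otimes P_{\theta,j}\widetilde{Q}_\theta\big), \] where $(\chi_\theta\otimes P_{\theta,j}\widetilde{Q}_\theta)\Phi=\chi_\theta\otimes P_{\theta,j}\widetilde{Q}_\theta\Phi$ for any $\Phi\in L(\mathcal{L}(X))$. The zero eigenvalues (in particular those corresponding to the space $L(X\setminus X_\theta)$) are omitted, and the eigenvalues $\{\lambda_{\theta,j}:\theta\in\{0,1\}^X,\ j=1,2,\dots,h(\theta)\}$ are not necessarily distinct.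
   Context: For a finite set $Y$, $L(Y)$ is the space of complex functions on $Y$ with scalar product $\langle f_1,f_2\rangle=\sum_{y\in Y}f_1(y)\overline{f_2(y)}$. Write $x\sim y$ if $\{x,y\}\in E$, and $\deg(x)=|\{y\in X:y\sim x\}|$. The set $\{0,1\}^X$ is a group under pointwise addition mod $2$; for $x\in X$, $\delta_x\in\{0,1\}^X$ is the function equal to $1$ at $x$ and $0$ elsewhere. For $\theta,\omega\in\{0,1\}^X$ put $\chi_\theta(\omega)=(-1)^{\sum_{x\in X}\theta(x)\omega(x)}$. Let $\mathcal{L}(X)=\{0,1\}^X\times X$; for $F\in L(\{0,1\}^X)$ and $f\in L(X)$, $(F\otimes f)(\omega,x)=F(\omega)f(x)$. The Markov operator of the vertex lamplighter random walk is the linear operator on $L(\mathcal{L}(X))$ determined by \[ [\mathcal{M}_X(F\otimes f)](\omega,x)=\frac{1}{4\deg(x)}\sum_{y\sim x}\big[F(\omega)+F(\omega+\delta_x)+F(\omega+\delta_y)+F(\omega+\delta_x+\delta_y)\big]f(y). \] For $\theta\in\{0,1\}^X$ let $X_\theta=\{x\in X:\theta(x)=0\}$ and define $M_\theta:L(X)\to L(X)$ by $(M_\theta f)(x)=\frac{1}{\deg(x)}\sum_{y\in X_\theta,\,y\sim x}f(y)$ if $\theta(x)=0$, and $(M_\theta f)(x)=0$ if $\theta(x)=1$. The space $L(X\setminus X_\theta)$ is regarded as the subspace of functions in $L(X)$ vanishing on $X_\theta$. For $\Phi\in L(\mathcal{L}(X))$, $(\widetilde{Q}_\theta\Phi)(x)=\frac{1}{2^{|X|}}\sum_{\omega\in\{0,1\}^X}\Phi(\omega,x)\chi_\theta(\omega)$,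 so $\widetilde{Q}_\theta:L(\mathcal{L}(X))\to L(X)$. *)

theory Defs
  imports Complex_Main "HOL-Library.Z2" "HOL-Library.Function_Algebras"
begin

section \<open>Operators on spaces of complex functions on a finite set\<close>

text \<open>\<open>inner_on w\<close> is the scalar product with weight \<open>w\<close>; the unweighted scalar product
  of \<open>L(Y)\<close> is the case \<open>w = (\<lambda>_. 1)\<close>.\<close>

definition inner_on :: "('b::finite \<Rightarrow> real) \<Rightarrow> ('b \<Rightarrow> complex) \<Rightarrow> ('b \<Rightarrow> complex) \<Rightarrow> complex" where
  "inner_on w f g = (\<Sum>y\<in>UNIV. of_real (w y) * f y * cnj (g y))"

definition eigenspace :: "(('b \<Rightarrow> complex) \<Rightarrow> ('b \<Rightarrow> complex)) \<Rightarrow> complex \<Rightarrow> ('b \<Rightarrow> complex) set" where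
  "eigenspace T c = {f. T f = (\<lambda>y. c * f y)}"

definition eigenvalue :: "(('b \<Rightarrow> complex) \<Rightarrow> ('b \<Rightarrow> complex)) \<Rightarrow> complex \<Rightarrow> bool" where
  "eigenvalue T c \<longleftrightarrow> (\<exists>f\<in>eigenspace T c. f \<noteq> 0)"

definition nonzero_eigenvalues :: "(('b \<Rightarrow> complex) \<Rightarrow> ('b \<Rightarrow> complex)) \<Rightarrow> complex set" where
  "nonzero_eigenvalues T = {c. c \<noteq> 0 \<and> eigenvalue T c}"

text \<open>Only meaningful for a linear subspace \<open>U\<close> and a positive definite form \<open>ip\<close>; the
  vector described then exists and is unique because \<open>L(Y)\<close> has finite dimension.\<close>

definition orth_proj ::
  "(('b \<Rightarrow> complex) \<Rightarrow> ('b \<Rightarrow> complex) \<Rightarrow> complex) \<Rightarrow> ('b \<Rightarrow> complex) set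
     \<Rightarrow> ('b \<Rightarrow> complex) \<Rightarrow> ('b \<Rightarrow> complex)" where
  "orth_proj ip U f = (THE g. g \<in> U \<and> (\<forall>u\<in>U. ip (f - g) u = 0))"


section \<open>Graphs and lamp configurations\<close>

text \<open>The vertex set is the whole finite type; loops are excluded because \<open>{x, x}\<close> has one
  element.\<close>

definition simple_graph :: "'a set set \<Rightarrow> bool" where
  "simple_graph E \<longleftrightarrow> (\<forall>e\<in>E. card e = 2)"

definition neighbours :: "'a set set \<Rightarrow> 'a \<Rightarrow> 'a set" where
  "neighbours E x = {y. {x, y} \<in> E}"

definition deg :: "'a set set \<Rightarrow> 'a \<Rightarrow> nat" where
  "deg E x = card (neighbours E x)"

instance bit :: finite
proof
  have "(UNIV :: bit set) \<subseteq> {0, 1}"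
    using bit_not_zero_iff by blast
  then show "finite (UNIV :: bit set)"
    by (rule finite_subset) simp
qed

definition delta :: "'a \<Rightarrow> 'a \<Rightarrow> bit" where
  "delta x = (\<lambda>z. if z = x then 1 else 0)"

definition chi :: "('a::finite \<Rightarrow> bit) \<Rightarrow> ('a \<Rightarrow> bit) \<Rightarrow> complex" where
  "chi \<theta> \<omega> = (- 1) ^ (\<Sum>x\<in>UNIV. of_bit (\<theta> x) * of_bit (\<omega> x) :: nat)"

definition tensor :: "(('a \<Rightarrow> bit) \<Rightarrow> complex) \<Rightarrow> ('a \<Rightarrow> complex) \<Rightarrow> (('a \<Rightarrow> bit) \<times> 'a \<Rightarrow> complex)"
    (infixr "\<otimes>" 70) where
  "F \<otimes> f = (\<lambda>(\<omega>, x). F \<omega> * f x)"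


section \<open>The lamplighter walk\<close>

text \<open>At an isolated vertex the operators below give \<open>0\<close>: the sums are empty, and \<open>1/0 = 0\<close>.\<close>

definition lamplighter_markov ::
  "'a::finite set set \<Rightarrow> (('a \<Rightarrow> bit) \<times> 'a \<Rightarrow> complex) \<Rightarrow> (('a \<Rightarrow> bit) \<times> 'a \<Rightarrow> complex)" where
  "lamplighter_markov E \<Phi> = (\<lambda>(\<omega>, x). 1 / (4 * of_nat (deg E x)) *
     (\<Sum>y\<in>neighbours E x. \<Phi> (\<omega>, y) + \<Phi> (\<omega> + delta x, y) + \<Phi> (\<omega> + delta y, y)
        + \<Phi> (\<omega> + delta x + delta y, y)))"

definition zero_set :: "('a \<Rightarrow> bit) \<Rightarrow> 'a set" where
  "zero_set \<theta> = {x. \<theta> x = 0}"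

definition M_op :: "'a::finite set set \<Rightarrow> ('a \<Rightarrow> bit) \<Rightarrow> ('a \<Rightarrow> complex) \<Rightarrow> ('a \<Rightarrow> complex)" where
  "M_op E \<theta> f = (\<lambda>x. if \<theta> x = 0
     then 1 / of_nat (deg E x) * (\<Sum>y\<in>zero_set \<theta> \<inter> neighbours E x. f y) else 0)"

definition Q_op :: "('a::finite \<Rightarrow> bit) \<Rightarrow> (('a \<Rightarrow> bit) \<times> 'a \<Rightarrow> complex) \<Rightarrow> ('a \<Rightarrow> complex)" where
  "Q_op \<theta> \<Phi> = (\<lambda>x. 1 / 2 ^ card (UNIV :: 'a set) * (\<Sum>\<omega>\<in>UNIV. \<Phi> (\<omega>, x) * chi \<theta> \<omega>))"

definition chi_tensor_op ::
  "('a::finite \<Rightarrow> bit) \<Rightarrow> ((('a \<Rightarrow> bit) \<times> 'a \<Rightarrow> complex) \<Rightarrow> ('a \<Rightarrow> complex))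
     \<Rightarrow> (('a \<Rightarrow> bit) \<times> 'a \<Rightarrow> complex) \<Rightarrow> (('a \<Rightarrow> bit) \<times> 'a \<Rightarrow> complex)" where
  "chi_tensor_op \<theta> T \<Phi> = chi \<theta> \<otimes> T \<Phi>"


text \<open>\<^const>\<open>lamplighter_markov\<close> is the unique linear operator with the defining values on
  elementary tensors.\<close>

lemma lamplighter_markov_tensor:
  "lamplighter_markov E (F \<otimes> f) (\<omega>, x) = 1 / (4 * of_nat (deg E x)) *
     (\<Sum>y\<in>neighbours E x. (F \<omega> + F (\<omega> + delta x) + F (\<omega> + delta y)
        + F (\<omega> + delta x + delta y)) * f y)"
  by (simp add: lamplighter_markov_def tensor_def distrib_right)

lemma lamplighter_markov_add:
  "lamplighter_markov E (\<Phi> + \<Psi>) = lamplighter_markov E \<Phi> + lamplighter_markov E \<Psi>"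
  by (rule ext) (simp add: lamplighter_markov_def sum.distrib distrib_left add_divide_distrib
      split: prod.split)

lemma lamplighter_markov_scale:
  "lamplighter_markov E (\<lambda>p. c * \<Phi> p) = (\<lambda>p. c * lamplighter_markov E \<Phi> p)"
  by (rule ext) (simp add: lamplighter_markov_def sum_distrib_left distrib_left
      mult.left_commute split: prod.split)

lemma lamplighter_markov_unique:
  fixes T :: "(('a::finite \<Rightarrow> bit) \<times> 'a \<Rightarrow> complex) \<Rightarrow> (('a \<Rightarrow> bit) \<times> 'a \<Rightarrow> complex)"
  assumes add: "\<And>\<Phi> \<Psi>. T (\<Phi> + \<Psi>) = T \<Phi> + T \<Psi>"
    and scale: "\<And>c \<Phi>. T (\<lambda>p. c * \<Phi> p) = (\<lambda>p. c * T \<Phi> p)"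
    and tensor: "\<And>F f \<omega> x. T (F \<otimes> f) (\<omega>, x) = 1 / (4 * of_nat (deg E x)) *
      (\<Sum>y\<in>neighbours E x. (F \<omega> + F (\<omega> + delta x) + F (\<omega> + delta y)
        + F (\<omega> + delta x + delta y)) * f y)"
  shows "T = lamplighter_markov E"
proof
  fix \<Phi> :: "('a \<Rightarrow> bit) \<times> 'a \<Rightarrow> complex"
  define e where "e = (\<lambda>q :: ('a \<Rightarrow> bit) \<times> 'a.
    (\<lambda>\<omega>. of_bool (\<omega> = fst q)) \<otimes> (\<lambda>x. of_bool (x = snd q) :: complex))"
  have e: "T (e q) = lamplighter_markov E (e q)" for q
    by (rule ext) (auto simp: e_def tensor lamplighter_markov_tensor)
  have eq: "T (\<Sum>q\<in>S. (\<lambda>p. \<Phi> q * e q p)) = lamplighter_markov E (\<Sum>q\<in>S. (\<lambda>p. \<Phi> q * e q p))"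
    if "finite S" for S
    using that
  proof (induction S)
    case empty
    show ?case
      using scale[of 0 0] lamplighter_markov_scale[of E 0 0] by (simp add: zero_fun_def)
  next
    case (insert q S)
    then show ?case
      by (simp only: sum.insert add lamplighter_markov_add scale lamplighter_markov_scale e
          not_False_eq_True)
  qed
  have expand: "(\<Sum>q\<in>UNIV. (\<lambda>p. \<Phi> q * e q p)) = \<Phi>"
  proof
    fix p :: "('a \<Rightarrow> bit) \<times> 'a"
    have "(\<Sum>q\<in>S. (\<lambda>p. \<Phi> q * e q p)) p = (\<Sum>q\<in>S. \<Phi> q * e q p)" if "finite S" for S
      using that by induction auto
    then have "(\<Sum>q\<in>UNIV. (\<lambda>p. \<Phi> q * e q p)) p = (\<Sum>q\<in>UNIV. \<Phi> q * e q p)"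
      by simp
    also have "\<dots> = (\<Sum>q\<in>UNIV. if q = p then \<Phi> q else 0)"
      by (rule sum.cong) (auto simp: e_def tensor_def prod_eq_iff split: prod.split)
    finally show "(\<Sum>q\<in>UNIV. (\<lambda>p. \<Phi> q * e q p)) p = \<Phi> p"
      by simp
  qed
  show "T \<Phi> = lamplighter_markov E \<Phi>"
    using eq[OF finite, of UNIV] unfolding expand .
qed

text \<open>\<^const>\<open>M_op\<close> is symmetric for \<open>inner_on w\<close>, hence has a spectral decomposition, when the
  walk is reversible for \<open>w\<close>. This holds on every graph for \<open>w x = max 1 (deg x)\<close>, but for
  \<open>w = (\<lambda>_. 1)\<close> only if adjacent vertices have equal degrees.\<close>

lemma M_op_symmetric:
  fixes f g :: "'a::finite \<Rightarrow> complex"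
  assumes rev: "\<And>x y. {x, y} \<in> E \<Longrightarrow> w x * real (deg E y) = w y * real (deg E x)"
  shows "inner_on w (M_op E \<theta> f) g = inner_on w f (M_op E \<theta> g)"
proof -
  define k :: "'a \<Rightarrow> 'a \<Rightarrow> complex" where
    "k x y = (if \<theta> x = 0 \<and> \<theta> y = 0 \<and> {x, y} \<in> E then of_real (w x / real (deg E x)) else 0)" for x y
  have k_sym: "k x y = k y x" for x y
  proof (cases "{x, y} \<in> E")
    case True
    then have "y \<in> neighbours E x" "x \<in> neighbours E y"
      by (auto simp: neighbours_def insert_commute)
    then have "deg E x \<noteq> 0" "deg E y \<noteq> 0"
      by (auto simp: deg_def)
    then have "w x / real (deg E x) = w y / real (deg E y)"
      using rev[OF True] by (simp add: divide_simps)
    then show ?thesis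
      by (simp add: k_def insert_commute)
  qed (simp add: k_def insert_commute)
  have M: "of_real (w x) * M_op E \<theta> f x = (\<Sum>y\<in>UNIV. k x y * f y)" for x f
  proof -
    have "(\<Sum>y\<in>UNIV. k x y * f y) = (\<Sum>y\<in>{y. \<theta> x = 0 \<and> \<theta> y = 0 \<and> {x, y} \<in> E}. k x y * f y)"
      by (rule sum.mono_neutral_right) (auto simp: k_def)
    also have "\<dots> = of_real (w x) * M_op E \<theta> f x"
    proof (cases "\<theta> x = 0")
      case True
      have "{y. \<theta> x = 0 \<and> \<theta> y = 0 \<and> {x, y} \<in> E} = zero_set \<theta> \<inter> neighbours E x"
        using True by (auto simp: zero_set_def neighbours_def)
      moreover have "k x y = of_real (w x) * (1 / of_nat (deg E x))"
        if "y \<in> zero_set \<theta> \<inter> neighbours E x" for y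
        using that True by (auto simp: k_def zero_set_def neighbours_def)
      ultimately show ?thesis
        using True by (simp add: M_op_def sum_distrib_left mult.assoc)
    qed (simp add: M_op_def)
    finally show ?thesis by simp
  qed
  have k_cnj: "cnj (k x y) = k x y" for x y
    by (simp add: k_def)
  have "inner_on w (M_op E \<theta> f) g = (\<Sum>x\<in>UNIV. \<Sum>y\<in>UNIV. k x y * f y * cnj (g x))"
    by (simp add: inner_on_def M sum_distrib_right)
  also have "\<dots> = (\<Sum>y\<in>UNIV. \<Sum>x\<in>UNIV. k x y * f y * cnj (g x))"
    by (rule sum.swap)
  also have "\<dots> = (\<Sum>y\<in>UNIV. \<Sum>x\<in>UNIV. f y * cnj (k y x * g x))"
  proof (intro sum.cong refl)
    fix x y
    show "k x y * f y * cnj (g x) = f y * cnj (k y x * g x)"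
      unfolding k_sym[of x y] complex_cnj_mult k_cnj by (simp only: mult_ac)
  qed
  also have "\<dots> = (\<Sum>y\<in>UNIV. f y * cnj (\<Sum>x\<in>UNIV. k y x * g x))"
    by (simp only: cnj_sum sum_distrib_left)
  also have "\<dots> = inner_on w f (M_op E \<theta> g)"
  proof -
    have "f y * cnj (\<Sum>x\<in>UNIV. k y x * g x) = of_real (w y) * f y * cnj (M_op E \<theta> g y)" for y
      unfolding M[symmetric] complex_cnj_mult complex_cnj_complex_of_real by (simp only: mult_ac)
    then show ?thesis
      by (simp only: inner_on_def)
  qed
  finally show ?thesis .
qed

end

theory Submission
  imports Defs "HOL-Library.Cardinality"
begin

text \<open>
  Characters diagonalise the lamp coordinate: for \<open>y\<close> adjacent to \<open>x\<close>, averaging \<open>\<chi>\<^sub>\<theta>\<close> over the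
  four configurations obtained by switching the lamps at \<open>x\<close> and \<open>y\<close> gives \<open>\<chi>\<^sub>\<theta>\<close> if
  \<open>\<theta> x = \<theta> y = 0\<close> and \<open>0\<close> otherwise. Hence the lamplighter operator maps \<open>\<chi>\<^sub>\<theta> \<otimes> f\<close> to
  \<open>\<chi>\<^sub>\<theta> \<otimes> M\<^sub>\<theta> f\<close>, and Fourier inversion and Parseval on \<open>{0,1}\<^sup>X\<close> reduce everything to the
  operators \<open>M\<^sub>\<theta>\<close>. The eigenvalues of \<open>M\<^sub>\<theta>\<close> are real because \<open>M\<^sub>\<theta>\<close> is symmetric for the degree
  weight; therefore the given decomposition makes \<open>M\<^sub>\<theta>\<close> symmetric for the given weight too, and
  its eigenspaces are orthogonal for that weight.
\<close>

section \<open>Orthogonal projections in spaces of functions\<close>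

text \<open>Gives \<open>fn.subspace\<close> over the complex scalars, with scaling in the pointwise
  form used by \<open>eigenspace\<close>.\<close>

interpretation fn: vector_space "\<lambda>(c::complex) (f::'b \<Rightarrow> complex) y. c * f y"
  by unfold_locales (auto simp: fun_eq_iff algebra_simps)

lemma sum_fun_eq: "(\<Sum>i\<in>I. f i) = (\<lambda>y. \<Sum>i\<in>I. f i y)"
  for f :: "'i \<Rightarrow> 'b \<Rightarrow> complex"
  by (induction I rule: infinite_finite_induct) (auto simp: fun_eq_iff)

lemma inner_on_add: "inner_on w (f + g) u = inner_on w f u + inner_on w g u"
  by (simp add: inner_on_def sum.distrib algebra_simps)

lemma inner_on_diff: "inner_on w (f - g) u = inner_on w f u - inner_on w g u"
  by (simp add: inner_on_def sum_subtractf algebra_simps)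

lemma inner_on_scale: "inner_on w (\<lambda>y. c * f y) u = c * inner_on w f u"
  by (simp add: inner_on_def sum_distrib_left mult_ac)

lemma cnj_inner_on: "cnj (inner_on w f g) = inner_on w g f"
  by (simp add: inner_on_def mult_ac)

lemma inner_on_add_right: "inner_on w u (f + g) = inner_on w u f + inner_on w u g"
  by (metis cnj_inner_on complex_cnj_add inner_on_add)

lemma inner_on_scale_right: "inner_on w u (\<lambda>y. c * f y) = cnj c * inner_on w u f"
  by (metis cnj_inner_on complex_cnj_mult inner_on_scale)

lemma inner_on_zero [simp]: "inner_on w 0 u = 0" "inner_on w u 0 = 0"
  by (simp_all add: inner_on_def)

lemma inner_on_sum: "inner_on w (\<lambda>y. \<Sum>i\<in>I. f i y) u = (\<Sum>i\<in>I. inner_on w (f i) u)"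
  by (simp add: inner_on_def sum_distrib_left sum_distrib_right sum.swap[of _ UNIV])

lemma inner_on_sum_right: "inner_on w u (\<lambda>y. \<Sum>i\<in>I. f i y) = (\<Sum>i\<in>I. inner_on w u (f i))"
  by (simp add: inner_on_def sum_distrib_left sum.swap[of _ UNIV])

lemma inner_on_self_eq_0_iff:
  assumes "\<forall>y. w y > 0"
  shows "inner_on w f f = 0 \<longleftrightarrow> f = 0"
proof
  assume "inner_on w f f = 0"
  moreover have "inner_on w f f = of_real (\<Sum>y\<in>UNIV. w y * (cmod (f y))\<^sup>2)"
    unfolding inner_on_def of_real_sum
    by (rule sum.cong) (simp_all add: complex_norm_square[symmetric] mult.assoc)
  ultimately have "(\<Sum>y\<in>UNIV. w y * (cmod (f y))\<^sup>2) = 0"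
    by (metis of_real_eq_0_iff)
  then have "w y * (cmod (f y))\<^sup>2 = 0" for y
    using assms by (subst (asm) sum_nonneg_eq_0_iff) (auto simp: less_imp_le)
  then show "f = 0"
    using assms by (auto simp: fun_eq_iff less_le)
qed simp

text \<open>Resolves the definite description in \<open>orth_proj\<close>: two candidates differ by
  an element of \<open>U\<close> that is orthogonal to all of \<open>U\<close>, hence to itself, and
  positivity of the weight makes it zero.\<close>

lemma orth_proj_eqI:
  assumes "\<forall>y. w y > 0" "fn.subspace U" "g \<in> U" "\<And>u. u \<in> U \<Longrightarrow> inner_on w (f - g) u = 0"
  shows "orth_proj (inner_on w) U f = g"
  unfolding orth_proj_def
proof (rule the_equality)
  fix g' assume g': "g' \<in> U \<and> (\<forall>u\<in>U. inner_on w (f - g') u = 0)"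
  have "g' - g \<in> U"
    using assms g' fn.subspace_diff by blast
  then have "inner_on w (g' - g) (g' - g) = inner_on w (f - g) (g' - g) - inner_on w (f - g') (g' - g)"
    by (simp add: inner_on_diff)
  also have "\<dots> = 0"
    using \<open>g' - g \<in> U\<close> assms g' by simp
  finally show "g' = g"
    using inner_on_self_eq_0_iff[OF assms(1)] by simp
qed (use assms in blast)

text \<open>Induction on the support: a subspace whose functions live on \<open>insert a S\<close> is either supported
  on \<open>S\<close> or has codimension one over its functions vanishing at \<open>a\<close>; one Gram-Schmidt step
  deals with the extra dimension.\<close>

lemma ex_projection_supported:
  assumes w: "\<forall>y. w y > 0" and S: "finite S"
  shows "fn.subspace U \<Longrightarrow> (\<And>u y. u \<in> U \<Longrightarrow> y \<notin> S \<Longrightarrow> u y = 0) \<Longrightarrow>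
    \<exists>g\<in>U. \<forall>u\<in>U. inner_on w (f - g) u = 0"
  using S
proof (induction S arbitrary: U f)
  case empty
  then have "\<forall>u\<in>U. u = 0"
    by (auto simp: fun_eq_iff)
  then show ?case
    using fn.subspace_0[OF empty(1)] by (intro bexI[of _ 0]) (auto simp del: zero_fun_apply)
next
  case (insert a S)
  define U0 where "U0 = {u \<in> U. u a = 0}"
  have U0: "fn.subspace U0"
    using insert.prems(1) by (auto simp: fn.subspace_def U0_def)
  have "u y = 0" if "u \<in> U0" "y \<notin> S" for u y
    using that insert.prems(2)[of u y] by (cases "y = a") (auto simp: U0_def)
  with U0 have proj0: "\<exists>g\<in>U0. \<forall>u\<in>U0. inner_on w (f - g) u = 0" for f
    by (intro insert.IH) auto
  show ?case
  proof (cases "U = U0")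
    case True
    then show ?thesis using proj0 by metis
  next
    case False
    then obtain v where v: "v \<in> U" "v a \<noteq> 0"
      by (auto simp: U0_def)
    \<comment> \<open>Gram-Schmidt step: \<open>e\<close> is the part of \<open>v\<close> orthogonal
      to \<open>U0\<close>. Since \<open>v0\<close> vanishes at \<open>a\<close>,
      \<open>e a = v a\<close> is still nonzero.\<close>
    obtain v0 where v0: "v0 \<in> U0" "\<And>u. u \<in> U0 \<Longrightarrow> inner_on w (v - v0) u = 0"
      using proj0 by blast
    define e where "e = v - v0"
    have e: "e \<in> U" "e a \<noteq> 0" "\<And>u. u \<in> U0 \<Longrightarrow> inner_on w e u = 0"
      using v v0 fn.subspace_diff[OF insert.prems(1)] by (auto simp: e_def U0_def)
    have e': "inner_on w u e = 0" if "u \<in> U0" for u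
      using e(3)[OF that] cnj_inner_on[of w e u] by simp
    have ee: "inner_on w e e \<noteq> 0"
      using e(2) inner_on_self_eq_0_iff[OF w] by auto
    obtain f0 where f0: "f0 \<in> U0" "\<And>u. u \<in> U0 \<Longrightarrow> inner_on w (f - f0) u = 0"
      using proj0 by blast
    define c where "c = inner_on w f e / inner_on w e e"
    define g where "g = f0 + (\<lambda>y. c * e y)"
    have g: "g \<in> U"
      using f0(1) e(1) insert.prems(1) by (auto simp: g_def U0_def fn.subspace_def)
    have diff: "inner_on w (f - g) u = inner_on w (f - f0) u - c * inner_on w e u" for u
      by (simp add: g_def inner_on_diff inner_on_add inner_on_scale)
    have ge: "inner_on w (f - g) e = 0"
      using ee e'[OF f0(1)] unfolding diff by (simp add: inner_on_diff c_def)
    have "inner_on w (f - g) u = 0" if u: "u \<in> U" for u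
    proof -
      \<comment> \<open>Removing the multiple of \<open>e\<close> that matches \<open>u\<close> at
        \<open>a\<close> lands in \<open>U0\<close>, so \<open>U\<close> is spanned by
        \<open>U0\<close> and \<open>e\<close>, and orthogonality need only be checked on
        these.\<close>
      define u0 where "u0 = u - (\<lambda>y. (u a / e a) * e y)"
      have "u0 \<in> U"
        unfolding u0_def
        using fn.subspace_diff[OF insert.prems(1) u fn.subspace_scale[OF insert.prems(1) e(1)]] .
      then have "u0 \<in> U0"
        using e(2) by (auto simp: U0_def u0_def)
      then have "inner_on w (f - g) u0 = 0"
        using diff e(3) f0(2) by simp
      moreover have "u = u0 + (\<lambda>y. (u a / e a) * e y)"
        by (simp add: u0_def)
      ultimately show ?thesis
        using ge by (metis add.right_neutral inner_on_add_right inner_on_scale_right mult_zero_right)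
    qed
    then show ?thesis using g by blast
  qed
qed

text \<open>Every function is supported on the finite set \<open>UNIV\<close>, so the preceding
  existence result reaches every subspace; with uniqueness, \<open>orth_proj\<close> is a genuine
  projection.\<close>

lemma
  assumes "\<forall>y. w y > 0" "fn.subspace U"
  shows orth_proj_in: "orth_proj (inner_on w) U f \<in> U" (is ?A)
    and orth_proj_orth: "u \<in> U \<Longrightarrow> inner_on w (f - orth_proj (inner_on w) U f) u = 0"
      (is "_ \<Longrightarrow> ?B")
proof -
  obtain g where "g \<in> U" "\<And>u. u \<in> U \<Longrightarrow> inner_on w (f - g) u = 0"
    using ex_projection_supported[OF assms(1) finite assms(2), of UNIV] by blast
  with orth_proj_eqI[OF assms, of g f] show ?A "u \<in> U \<Longrightarrow> ?B"
    by simp_all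
qed

text \<open>Both sides equal the scalar product of the two projections, because residuals are
  orthogonal to \<open>U\<close>.\<close>

lemma orth_proj_symmetric:
  assumes "\<forall>y. w y > 0" "fn.subspace U"
  shows "inner_on w (orth_proj (inner_on w) U f) g = inner_on w f (orth_proj (inner_on w) U g)"
proof -
  let ?P = "orth_proj (inner_on w) U"
  have *: "inner_on w f (?P g) = inner_on w (?P f) (?P g)" for f g
    using orth_proj_orth[OF assms orth_proj_in[OF assms], of f g] by (simp add: inner_on_diff)
  show ?thesis
    by (metis * cnj_inner_on)
qed

section \<open>Symmetric operators\<close>

lemma real_eigenvalue_symmetric:
  assumes "\<forall>y. w y > 0" "\<And>f g. inner_on w (T f) g = inner_on w f (T g)" "eigenvalue T c"
  shows "cnj c = c"
proof -
  obtain f where "T f = (\<lambda>y. c * f y)" "f \<noteq> 0"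
    using assms(3) by (auto simp: eigenvalue_def eigenspace_def)
  then show ?thesis
    using assms(2)[of f f] inner_on_self_eq_0_iff[OF assms(1), of f]
    by (simp add: inner_on_scale inner_on_scale_right)
qed

text \<open>The eigenvalue \<open>d\<close> is pulled out of the conjugate-linear argument, which is
  why it is the one assumed real.\<close>

lemma eigenspaces_orthogonal_symmetric:
  assumes "\<And>f g. inner_on w (T f) g = inner_on w f (T g)" "cnj d = d" "c \<noteq> d"
    and "f \<in> eigenspace T c" "g \<in> eigenspace T d"
  shows "inner_on w f g = 0"
proof -
  have "c * inner_on w f g = d * inner_on w f g"
    using assms(1)[of f g] assms(2,4,5)
    by (simp add: eigenspace_def inner_on_scale inner_on_scale_right)
  then show ?thesis using assms(3) by simp
qed

text \<open>Serves to derive symmetry for the weight of the main theorem from the decomposition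
  itself, since reversibility for that weight is not among the assumptions there.\<close>

lemma symmetric_spectral_sum:
  fixes P :: "'i \<Rightarrow> ('b::finite \<Rightarrow> complex) \<Rightarrow> 'b \<Rightarrow> complex"
  assumes "T = (\<lambda>f x. \<Sum>i\<in>I. c i * P i f x)" "\<And>i. i \<in> I \<Longrightarrow> cnj (c i) = c i"
    and "\<And>i f g. i \<in> I \<Longrightarrow> inner_on w (P i f) g = inner_on w f (P i g)"
  shows "inner_on w (T f) g = inner_on w f (T g)"
  unfolding assms(1) inner_on_sum inner_on_sum_right
  by (rule sum.cong) (simp_all add: inner_on_scale inner_on_scale_right assms)

lemma subspace_eigenspace:
  fixes T :: "('b \<Rightarrow> complex) \<Rightarrow> 'b \<Rightarrow> complex"
  assumes "\<And>f g. T (f + g) = T f + T g" "\<And>c f. T (\<lambda>y. c * f y) = (\<lambda>y. c * T f y)"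
  shows "fn.subspace (eigenspace T c)"
  unfolding fn.subspace_def
proof (intro conjI ballI allI)
  have "T 0 + 0 = T 0 + T 0"
    using assms(1)[of 0 0] by (simp only: add_0_left add_0_right)
  then have "T 0 = 0"
    by (metis add_left_cancel)
  moreover have "(\<lambda>y. c * 0 y) = (0 :: 'b \<Rightarrow> complex)"
    by (rule ext) simp
  ultimately show "0 \<in> eigenspace T c"
    by (simp only: eigenspace_def mem_Collect_eq)
next
  fix f g assume "f \<in> eigenspace T c" "g \<in> eigenspace T c"
  then have "T f = (\<lambda>y. c * f y)" "T g = (\<lambda>y. c * g y)"
    by (simp_all only: eigenspace_def mem_Collect_eq)
  moreover have "(\<lambda>y. c * f y) + (\<lambda>y. c * g y) = (\<lambda>y. c * (f + g) y)"
    by (rule ext) (simp add: distrib_left)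
  ultimately show "f + g \<in> eigenspace T c"
    by (simp only: eigenspace_def mem_Collect_eq assms(1))
next
  fix d f assume "f \<in> eigenspace T c"
  then have "T f = (\<lambda>y. c * f y)"
    by (simp only: eigenspace_def mem_Collect_eq)
  then show "(\<lambda>y. d * f y) \<in> eigenspace T c"
    unfolding eigenspace_def mem_Collect_eq assms(2)[of d f] by (simp only: mult.left_commute)
qed

section \<open>Eigenspaces and eigenvalues of the walk operators\<close>

lemma M_op_add: "M_op E \<theta> (f + g) = M_op E \<theta> f + M_op E \<theta> g"
  by (auto simp: M_op_def sum.distrib fun_eq_iff add_divide_distrib)

lemma M_op_scale: "M_op E \<theta> (\<lambda>y. c * f y) = (\<lambda>y. c * M_op E \<theta> f y)"
  by (auto simp: M_op_def sum_distrib_left fun_eq_iff mult_ac)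

lemma subspace_eigenspace_M_op: "fn.subspace (eigenspace (M_op E \<theta>) c)"
  by (rule subspace_eigenspace) (rule M_op_add M_op_scale)+

lemma subspace_eigenspace_lamplighter: "fn.subspace (eigenspace (lamplighter_markov E) c)"
  by (rule subspace_eigenspace) (rule lamplighter_markov_add lamplighter_markov_scale)+

text \<open>Being real does not depend on the scalar product, so the degree weight may be used here
  whatever weight the decomposition refers to. The \<open>max 1\<close> keeps it positive at
  isolated vertices.\<close>

lemma real_eigenvalue_M_op:
  assumes "eigenvalue (M_op E \<theta>) c"
  shows "cnj c = c"
proof (rule real_eigenvalue_symmetric[OF _ _ assms])
  fix f g
  show "inner_on (\<lambda>x. max 1 (real (deg E x))) (M_op E \<theta> f) g
      = inner_on (\<lambda>x. max 1 (real (deg E x))) f (M_op E \<theta> g)"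
  proof (rule M_op_symmetric)
    fix x y assume "{x, y} \<in> E"
    \<comment> \<open>Endpoints of an edge have positive degree, so there \<open>max 1\<close>
      returns the degree itself.\<close>
    then have "y \<in> neighbours E x" "x \<in> neighbours E y"
      by (auto simp: neighbours_def insert_commute)
    then have "deg E x \<noteq> 0" "deg E y \<noteq> 0"
      by (auto simp: deg_def)
    then show "max 1 (real (deg E x)) * real (deg E y) = max 1 (real (deg E y)) * real (deg E x)"
      by (simp add: max_def)
  qed
qed (simp add: max_def)

section \<open>Fourier analysis on lamp configurations\<close>

text \<open>The exponent in \<open>chi\<close> is additive only modulo 2; the product form lets
  multiplicativity be checked one vertex at a time.\<close>

lemma chi_prod: "chi \<theta> \<omega> = (\<Prod>x\<in>UNIV. if \<theta> x = 1 \<and> \<omega> x = 1 then - 1 else 1)"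
  unfolding chi_def power_sum by (rule prod.cong) auto

lemma chi_commute: "chi \<theta> \<omega> = chi \<omega> \<theta>"
  by (simp add: chi_prod conj_commute)

lemma chi_add_right: "chi \<theta> (\<omega> + \<eta>) = chi \<theta> \<omega> * chi \<theta> \<eta>"
  unfolding chi_prod prod.distrib[symmetric]
  by (rule prod.cong) (auto simp: bit_not_one_iff)

lemma chi_add_left: "chi (\<theta> + \<sigma>) \<omega> = chi \<theta> \<omega> * chi \<sigma> \<omega>"
  using chi_add_right by (metis chi_commute)

lemma chi_delta: "chi \<theta> (delta x) = (if \<theta> x = 0 then 1 else - 1)"
proof -
  have "chi \<theta> (delta x) = (\<Prod>z\<in>UNIV. if z = x then (if \<theta> x = 0 then 1 else - 1) else 1)"
    unfolding chi_prod delta_def by (rule prod.cong) auto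
  then show ?thesis by simp
qed

lemma cnj_chi [simp]: "cnj (chi \<theta> \<omega>) = chi \<theta> \<omega>"
  by (simp add: chi_def)

lemma bit_fun_add_self: "\<omega> + \<omega> = (0 :: 'a \<Rightarrow> bit)"
  by (simp add: fun_eq_iff)

lemma card_lamps: "card (UNIV :: ('a::finite \<Rightarrow> bit) set) = 2 ^ card (UNIV :: 'a set)"
proof -
  have "(UNIV :: bit set) = {0, 1}"
    using bit_not_zero_iff by blast
  then have "card (UNIV :: bit set) = card {0, 1 :: bit}" by (rule arg_cong)
  also have "\<dots> = 2" by simp
  finally show ?thesis by (simp add: card_fun)
qed

text \<open>If \<open>\<theta> x = 1\<close>, switching the lamp at \<open>x\<close> permutes the
  configurations and negates \<open>chi \<theta>\<close>, so the sum equals its own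
  negative.\<close>

lemma sum_chi:
  "(\<Sum>\<omega>\<in>UNIV. chi (\<theta> :: 'a::finite \<Rightarrow> bit) \<omega>) = (if \<theta> = 0 then 2 ^ card (UNIV :: 'a set) else 0)"
proof (cases "\<theta> = 0")
  case True
  then show ?thesis by (simp add: chi_prod card_lamps)
next
  case False
  then obtain x where x: "\<theta> x \<noteq> 0" by (auto simp: fun_eq_iff)
  have "bij (\<lambda>\<omega>. \<omega> + delta x)"
    by (rule o_bij[of "\<lambda>\<omega>. \<omega> + delta x"]) (auto simp: fun_eq_iff add.assoc)
  then have "(\<Sum>\<omega>\<in>UNIV. chi \<theta> \<omega>) = (\<Sum>\<omega>\<in>UNIV. chi \<theta> (\<omega> + delta x))"
    by (rule sum.reindex_bij_betw[symmetric])
  also have "\<dots> = - (\<Sum>\<omega>\<in>UNIV. chi \<theta> \<omega>)"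
    using x by (simp add: chi_add_right chi_delta sum_negf)
  finally show ?thesis using False by simp
qed

lemma chi_orthogonal:
  "(\<Sum>\<omega>\<in>UNIV. chi (\<theta> :: 'a::finite \<Rightarrow> bit) \<omega> * chi \<sigma> \<omega>)
    = (if \<theta> = \<sigma> then 2 ^ card (UNIV :: 'a set) else 0)"
proof -
  have "\<theta> + \<sigma> = 0 \<longleftrightarrow> \<theta> = \<sigma>"
    by (metis add_right_cancel bit_fun_add_self)
  then show ?thesis
    unfolding chi_add_left[symmetric] sum_chi by simp
qed

text \<open>Orthogonality of characters: \<open>Q_op \<theta>\<close> extracts the Fourier
  coefficient at \<open>\<theta>\<close> in the lamp coordinate, and is a left inverse of tensoring
  with \<open>chi \<theta>\<close>.\<close>

lemma Q_op_tensor: "Q_op \<theta> (chi \<sigma> \<otimes> f) = (if \<theta> = \<sigma> then f else 0)"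
proof
  fix x
  have "Q_op \<theta> (chi \<sigma> \<otimes> f) x
      = 1 / 2 ^ card (UNIV :: 'a set) * (\<Sum>\<omega>\<in>UNIV. chi \<theta> \<omega> * chi \<sigma> \<omega>) * f x"
    by (simp add: Q_op_def tensor_def sum_distrib_left sum_distrib_right mult_ac)
  then show "Q_op \<theta> (chi \<sigma> \<otimes> f) x = (if \<theta> = \<sigma> then f else 0) x"
    by (simp add: chi_orthogonal)
qed

lemma Q_op_diff: "Q_op \<theta> (\<Phi> - \<Psi>) = Q_op \<theta> \<Phi> - Q_op \<theta> \<Psi>"
  by (simp add: Q_op_def fun_eq_iff sum_subtractf algebra_simps diff_divide_distrib)

lemma Q_op_scale: "Q_op \<theta> (\<lambda>p. c * \<Phi> p) = (\<lambda>x. c * Q_op \<theta> \<Phi> x)"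
  by (simp add: Q_op_def fun_eq_iff sum_distrib_left mult_ac)

lemma Q_op_sum: "Q_op \<theta> (\<lambda>p. \<Sum>i\<in>I. \<Phi> i p) = (\<lambda>x. \<Sum>i\<in>I. Q_op \<theta> (\<Phi> i) x)"
  by (simp add: Q_op_def fun_eq_iff sum_distrib_left sum_distrib_right sum.swap[of _ UNIV])

text \<open>Uniqueness of Fourier coefficients, complementing the inversion formula below.\<close>

lemma Q_op_sum_tensor: "Q_op \<theta> (\<lambda>p. \<Sum>\<sigma>\<in>UNIV. (chi \<sigma> \<otimes> g \<sigma>) p) = g \<theta>"
proof
  fix x
  have "Q_op \<theta> (\<lambda>p. \<Sum>\<sigma>\<in>UNIV. (chi \<sigma> \<otimes> g \<sigma>) p) x = (\<Sum>\<sigma>\<in>UNIV. if \<theta> = \<sigma> then g \<sigma> x else 0)"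
    unfolding Q_op_sum by (rule sum.cong) (auto simp: Q_op_tensor)
  then show "Q_op \<theta> (\<lambda>p. \<Sum>\<sigma>\<in>UNIV. (chi \<sigma> \<otimes> g \<sigma>) p) x = g \<theta> x"
    by simp
qed

text \<open>The sum now runs over the characters. Because \<open>chi\<close> is symmetric in its two
  arguments, the same orthogonality relation applies with configurations in the role of
  characters.\<close>

lemma Fourier_inversion: "(\<lambda>p. \<Sum>\<theta>\<in>UNIV. (chi \<theta> \<otimes> Q_op \<theta> \<Phi>) p) = \<Phi>"
proof
  fix p :: "('a \<Rightarrow> bit) \<times> 'a"
  obtain \<omega> x where p: "p = (\<omega>, x)" by force
  let ?N = "2 ^ card (UNIV :: 'a set) :: complex"
  have "(\<Sum>\<theta>\<in>UNIV. (chi \<theta> \<otimes> Q_op \<theta> \<Phi>) p)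
      = (\<Sum>\<theta>\<in>UNIV. \<Sum>\<eta>\<in>UNIV. 1 / ?N * \<Phi> (\<eta>, x) * (chi \<omega> \<theta> * chi \<eta> \<theta>))"
    unfolding p tensor_def Q_op_def prod.case sum_distrib_left
    by (intro sum.cong refl) (simp only: chi_commute mult_ac)
  also have "\<dots> = (\<Sum>\<eta>\<in>UNIV. 1 / ?N * \<Phi> (\<eta>, x) * (\<Sum>\<theta>\<in>UNIV. chi \<omega> \<theta> * chi \<eta> \<theta>))"
    by (subst sum.swap) (simp add: sum_distrib_left)
  also have "\<dots> = (\<Sum>\<eta>\<in>UNIV. if \<omega> = \<eta> then \<Phi> (\<eta>, x) else 0)"
    by (rule sum.cong) (auto simp: chi_orthogonal)
  finally show "(\<Sum>\<theta>\<in>UNIV. (chi \<theta> \<otimes> Q_op \<theta> \<Phi>) p) = \<Phi> p"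
    by (simp add: p)
qed

text \<open>The weight ignores the lamps and \<open>chi\<close> is real, so summing over lamps first
  produces \<open>Q_op \<theta> \<Phi>\<close>; the power of 2 undoes the normalisation of
  \<open>Q_op\<close>.\<close>

lemma inner_on_tensor:
  "inner_on (w \<circ> snd) \<Phi> (chi \<theta> \<otimes> v) = 2 ^ card (UNIV :: 'a set) * inner_on w (Q_op \<theta> \<Phi>) v"
  for v :: "'a::finite \<Rightarrow> complex"
proof -
  have "inner_on (w \<circ> snd) \<Phi> (chi \<theta> \<otimes> v)
      = (\<Sum>\<omega>\<in>UNIV. \<Sum>x\<in>UNIV. of_real (w x) * \<Phi> (\<omega>, x) * (chi \<theta> \<omega> * cnj (v x)))"
    by (simp add: inner_on_def tensor_def sum.cartesian_product case_prod_beta flip: UNIV_Times_UNIV)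
  also have "\<dots> = (\<Sum>x\<in>UNIV. \<Sum>\<omega>\<in>UNIV. of_real (w x) * \<Phi> (\<omega>, x) * (chi \<theta> \<omega> * cnj (v x)))"
    by (rule sum.swap)
  also have "\<dots> = 2 ^ card (UNIV :: 'a set) * inner_on w (Q_op \<theta> \<Phi>) v"
    by (simp add: inner_on_def Q_op_def sum_distrib_left sum_distrib_right mult_ac)
  finally show ?thesis .
qed

lemma Parseval:
  "inner_on (w \<circ> snd) \<Phi> \<Psi>
    = 2 ^ card (UNIV :: 'a set) * (\<Sum>\<theta>\<in>UNIV. inner_on w (Q_op \<theta> \<Phi>) (Q_op \<theta> \<Psi>))"
  for w :: "'a::finite \<Rightarrow> real"
proof -
  have "inner_on (w \<circ> snd) \<Phi> \<Psi> = inner_on (w \<circ> snd) \<Phi> (\<lambda>p. \<Sum>\<theta>\<in>UNIV. (chi \<theta> \<otimes> Q_op \<theta> \<Psi>) p)"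
    by (simp only: Fourier_inversion)
  then show ?thesis
    by (simp add: inner_on_sum_right inner_on_tensor sum_distrib_left)
qed

section \<open>The lamplighter operator in Fourier coordinates\<close>

lemma lamplighter_chi_tensor: "lamplighter_markov E (chi \<theta> \<otimes> f) = chi \<theta> \<otimes> M_op E \<theta> f"
proof
  fix p :: "('a \<Rightarrow> bit) \<times> 'a"
  obtain \<omega> x where p: "p = (\<omega>, x)" by force
  \<comment> \<open>\<open>s y\<close> is the value of \<open>chi \<theta>\<close> at
    \<open>delta y\<close>, so the four lamp terms factor as
    \<open>(1 + s x) * (1 + s y)\<close>.\<close>
  define s :: "'a \<Rightarrow> complex" where "s y = (if \<theta> y = 0 then 1 else - 1)" for y
  have "lamplighter_markov E (chi \<theta> \<otimes> f) p = 1 / (4 * of_nat (deg E x)) *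
     (\<Sum>y\<in>neighbours E x. chi \<theta> \<omega> * ((1 + s x) * (1 + s y)) * f y)"
    unfolding p lamplighter_markov_tensor
    by (simp add: chi_add_right chi_delta s_def[symmetric] algebra_simps)
  \<comment> \<open>The factor \<open>1 + s y\<close> is 0 outside \<open>zero_set \<theta>\<close>
    and 2 on it. Likewise \<open>2 * (1 + s x)\<close> is 4 or 0, which cancels the 4 in the
    denominator or gives the zero branch of \<open>M_op\<close>.\<close>
  also have "(\<Sum>y\<in>neighbours E x. chi \<theta> \<omega> * ((1 + s x) * (1 + s y)) * f y)
      = (\<Sum>y\<in>zero_set \<theta> \<inter> neighbours E x. chi \<theta> \<omega> * ((1 + s x) * (1 + s y)) * f y)"
    by (rule sum.mono_neutral_right) (auto simp: s_def zero_set_def)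
  also have "\<dots> = (\<Sum>y\<in>zero_set \<theta> \<inter> neighbours E x. chi \<theta> \<omega> * (2 * (1 + s x)) * f y)"
    by (rule sum.cong) (auto simp: s_def zero_set_def)
  also have "\<dots> = chi \<theta> \<omega> * (2 * (1 + s x)) * (\<Sum>y\<in>zero_set \<theta> \<inter> neighbours E x. f y)"
    by (simp only: sum_distrib_left)
  finally show "lamplighter_markov E (chi \<theta> \<otimes> f) p = (chi \<theta> \<otimes> M_op E \<theta> f) p"
    by (simp add: p tensor_def M_op_def s_def)
qed

lemma lamplighter_markov_sum:
  "lamplighter_markov E (\<Sum>i\<in>I. \<Psi> i) = (\<Sum>i\<in>I. lamplighter_markov E (\<Psi> i))"
proof -
  have zero: "lamplighter_markov E 0 = 0"
    using lamplighter_markov_add[of E 0 0] by (simp del: zero_fun_apply)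
  show ?thesis
    by (induction I rule: infinite_finite_induct)
      (simp_all only: sum.infinite sum.empty sum.insert zero lamplighter_markov_add
        not_False_eq_True)
qed

lemma lamplighter_Fourier:
  "lamplighter_markov E \<Phi> = (\<lambda>p. \<Sum>\<theta>\<in>UNIV. (chi \<theta> \<otimes> M_op E \<theta> (Q_op \<theta> \<Phi>)) p)"
proof -
  have "lamplighter_markov E \<Phi> = lamplighter_markov E (\<Sum>\<theta>\<in>UNIV. chi \<theta> \<otimes> Q_op \<theta> \<Phi>)"
    by (simp only: sum_fun_eq Fourier_inversion)
  then show ?thesis
    by (simp only: lamplighter_markov_sum lamplighter_chi_tensor) (simp only: sum_fun_eq)
qed

text \<open>Each Fourier coefficient evolves separately, so the lamplighter operator is block
  diagonal with blocks \<open>M_op E \<theta>\<close>.\<close>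

lemma Q_op_lamplighter: "Q_op \<theta> (lamplighter_markov E \<Phi>) = M_op E \<theta> (Q_op \<theta> \<Phi>)"
  unfolding lamplighter_Fourier[of E \<Phi>] by (rule Q_op_sum_tensor)

text \<open>Holds for every \<open>\<theta>\<close>, even when \<open>c\<close> is not an eigenvalue
  of \<open>M_op E \<theta>\<close>: the coefficient is then the zero function, which
  \<open>eigenspace\<close> contains.\<close>

lemma Q_op_eigenspace:
  "\<Phi> \<in> eigenspace (lamplighter_markov E) c \<Longrightarrow> Q_op \<theta> \<Phi> \<in> eigenspace (M_op E \<theta>) c"
  using Q_op_lamplighter[of \<theta> E \<Phi>] by (simp add: eigenspace_def Q_op_scale)

lemma chi_tensor_eigenspace:
  "f \<in> eigenspace (M_op E \<theta>) c \<Longrightarrow> chi \<theta> \<otimes> f \<in> eigenspace (lamplighter_markov E) c"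
  by (auto simp: eigenspace_def lamplighter_chi_tensor) (auto simp: tensor_def)

lemma chi_tensor_eq_0_iff: "chi \<theta> \<otimes> f = 0 \<longleftrightarrow> f = 0"
proof
  assume "chi \<theta> \<otimes> f = 0"
  then show "f = 0"
    using Q_op_tensor[of \<theta> \<theta> f] by (simp add: Q_op_def fun_eq_iff)
qed (simp add: tensor_def fun_eq_iff)

section \<open>Projections onto subspaces attached to a single character\<close>

lemma subspace_chi_tensor:
  assumes "fn.subspace U"
  shows "fn.subspace ((\<otimes>) (chi \<theta>) ` U)"
  unfolding fn.subspace_def
proof (intro conjI ballI allI)
  show "0 \<in> (\<otimes>) (chi \<theta>) ` U"
    using chi_tensor_eq_0_iff[of \<theta> 0] fn.subspace_0[OF assms] by (metis image_eqI)
next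
  fix F G assume "F \<in> (\<otimes>) (chi \<theta>) ` U" "G \<in> (\<otimes>) (chi \<theta>) ` U"
  then obtain f g where "f \<in> U" "g \<in> U" "F = chi \<theta> \<otimes> f" "G = chi \<theta> \<otimes> g"
    by blast
  then have "f + g \<in> U" "F + G = chi \<theta> \<otimes> (f + g)"
    using assms by (auto simp: fn.subspace_def tensor_def fun_eq_iff distrib_left)
  then show "F + G \<in> (\<otimes>) (chi \<theta>) ` U" by blast
next
  fix c F assume "F \<in> (\<otimes>) (chi \<theta>) ` U"
  then obtain f where "f \<in> U" "F = chi \<theta> \<otimes> f"
    by blast
  then have "(\<lambda>y. c * f y) \<in> U" "(\<lambda>p. c * F p) = chi \<theta> \<otimes> (\<lambda>y. c * f y)"
    using assms by (auto simp: fn.subspace_def tensor_def fun_eq_iff)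
  then show "(\<lambda>p. c * F p) \<in> (\<otimes>) (chi \<theta>) ` U" by blast
qed

text \<open>By \<open>inner_on_tensor\<close>, testing the residual against
  \<open>chi \<theta> \<otimes> u\<close> amounts to testing the residual of
  \<open>Q_op \<theta> \<Phi>\<close> against \<open>u\<close>.\<close>

lemma chi_tensor_op_orth_proj:
  assumes w: "\<forall>x. w x > 0" and U: "fn.subspace U"
  shows "chi_tensor_op \<theta> (orth_proj (inner_on w) U \<circ> Q_op \<theta>)
    = orth_proj (inner_on (w \<circ> snd)) ((\<otimes>) (chi \<theta>) ` U)"
proof
  fix \<Phi>
  let ?P = "orth_proj (inner_on w) U"
  have "orth_proj (inner_on (w \<circ> snd)) ((\<otimes>) (chi \<theta>) ` U) \<Phi> = chi \<theta> \<otimes> ?P (Q_op \<theta> \<Phi>)"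
  proof (rule orth_proj_eqI[OF _ subspace_chi_tensor[OF U]])
    show "chi \<theta> \<otimes> ?P (Q_op \<theta> \<Phi>) \<in> (\<otimes>) (chi \<theta>) ` U"
      using orth_proj_in[OF w U] by blast
  next
    fix u assume "u \<in> (\<otimes>) (chi \<theta>) ` U"
    then show "inner_on (w \<circ> snd) (\<Phi> - chi \<theta> \<otimes> ?P (Q_op \<theta> \<Phi>)) u = 0"
      using orth_proj_orth[OF w U] by (auto simp: inner_on_tensor Q_op_diff Q_op_tensor)
  qed (simp add: w)
  then show "chi_tensor_op \<theta> (?P \<circ> Q_op \<theta>) \<Phi>
      = orth_proj (inner_on (w \<circ> snd)) ((\<otimes>) (chi \<theta>) ` U) \<Phi>"
    by (simp add: chi_tensor_op_def)
qed

text \<open>The arbitrary positive weight covers both the unweighted scalar product and the degree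
  weight. Equal eigenvalues may occur for different \<open>\<theta>\<close>, so a single summand may
  project onto only part of an eigenspace; hence the extra clause that regroups summands by
  eigenvalue.\<close>

theorem lemma3p3:
  fixes E :: "'a::finite set set"
    and w :: "'a \<Rightarrow> real"
    and h :: "('a \<Rightarrow> bit) \<Rightarrow> nat"
    and lam :: "('a \<Rightarrow> bit) \<Rightarrow> nat \<Rightarrow> complex"
    and P :: "('a \<Rightarrow> bit) \<Rightarrow> nat \<Rightarrow> ('a \<Rightarrow> complex) \<Rightarrow> ('a \<Rightarrow> complex)"
  assumes graph: "simple_graph E"
    and weight: "\<And>x. w x > 0"
    and eigenvalues: "\<And>\<theta>. bij_betw (lam \<theta>) {1..h \<theta>} (nonzero_eigenvalues (M_op E \<theta>))"
    and projections: "\<And>\<theta> j. j \<in> {1..h \<theta>} \<Longrightarrow>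
      P \<theta> j = orth_proj (inner_on w) (eigenspace (M_op E \<theta>) (lam \<theta> j))"
    and decomposition: "\<And>\<theta>. M_op E \<theta> = (\<lambda>f x. \<Sum>j=1..h \<theta>. lam \<theta> j * P \<theta> j f x)"
  shows
    "lamplighter_markov E
        = (\<lambda>\<Phi> p. \<Sum>\<theta>\<in>UNIV. \<Sum>j=1..h \<theta>. lam \<theta> j * chi_tensor_op \<theta> (P \<theta> j \<circ> Q_op \<theta>) \<Phi> p)
     \<and> (\<forall>\<theta>. \<forall>j\<in>{1..h \<theta>}.
          chi_tensor_op \<theta> (P \<theta> j \<circ> Q_op \<theta>)
            = orth_proj (inner_on (w \<circ> snd)) ((\<otimes>) (chi \<theta>) ` eigenspace (M_op E \<theta>) (lam \<theta> j))
          \<and> (\<otimes>) (chi \<theta>) ` eigenspace (M_op E \<theta>) (lam \<theta> j)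
              \<subseteq> eigenspace (lamplighter_markov E) (lam \<theta> j))
     \<and> (\<forall>\<theta> \<sigma>. \<forall>j\<in>{1..h \<theta>}. \<forall>i\<in>{1..h \<sigma>}. (\<theta>, j) \<noteq> (\<sigma>, i) \<longrightarrow>
          chi_tensor_op \<theta> (P \<theta> j \<circ> Q_op \<theta>) \<circ> chi_tensor_op \<sigma> (P \<sigma> i \<circ> Q_op \<sigma>) = 0)
     \<and> nonzero_eigenvalues (lamplighter_markov E) = {lam \<theta> j | \<theta> j. j \<in> {1..h \<theta>}}
     \<and> (\<forall>c\<in>nonzero_eigenvalues (lamplighter_markov E).
          orth_proj (inner_on (w \<circ> snd)) (eigenspace (lamplighter_markov E) c)
            = (\<lambda>\<Phi> p. \<Sum>\<theta>\<in>UNIV. \<Sum>j | j \<in> {1..h \<theta>} \<and> lam \<theta> j = c.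
                 chi_tensor_op \<theta> (P \<theta> j \<circ> Q_op \<theta>) \<Phi> p))
     \<and> (\<forall>\<theta> f. (\<forall>x\<in>zero_set \<theta>. f x = 0) \<longrightarrow> lamplighter_markov E (chi \<theta> \<otimes> f) = 0)"
proof -
  let ?L = "lamplighter_markov E"
  let ?V = "\<lambda>\<theta> j. eigenspace (M_op E \<theta>) (lam \<theta> j)"
  let ?T = "\<lambda>\<theta> j. chi_tensor_op \<theta> (P \<theta> j \<circ> Q_op \<theta>)"
  note V = subspace_eigenspace_M_op
  have w: "\<forall>x. w x > 0"
    using weight by simp
  have lam: "lam \<theta> j \<noteq> 0" "eigenvalue (M_op E \<theta>) (lam \<theta> j)" if "j \<in> {1..h \<theta>}" for \<theta> j
    using bij_betwE[OF eigenvalues[of \<theta>]] that by (auto simp: nonzero_eigenvalues_def)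
  have lam_inj: "inj_on (lam \<theta>) {1..h \<theta>}" for \<theta>
    using eigenvalues bij_betw_imp_inj_on by blast
  have lam_surj: "\<exists>j\<in>{1..h \<theta>}. c = lam \<theta> j" if "c \<noteq> 0" "eigenvalue (M_op E \<theta>) c" for \<theta> c
    using bij_betw_imp_surj_on[OF eigenvalues[of \<theta>]] that by (auto simp: nonzero_eigenvalues_def)
  have P_in: "P \<theta> j f \<in> ?V \<theta> j" if "j \<in> {1..h \<theta>}" for \<theta> j f
    using orth_proj_in[OF w V] projections[OF that] by simp
  have P_orth: "inner_on w (f - P \<theta> j f) u = 0" if "j \<in> {1..h \<theta>}" "u \<in> ?V \<theta> j" for \<theta> j f u
    using orth_proj_orth[OF w V that(2)] projections[OF that(1)] by simp
  have P_eq_0: "P \<theta> j f = 0" if "j \<in> {1..h \<theta>}" "\<And>u. u \<in> ?V \<theta> j \<Longrightarrow> inner_on w f u = 0" for \<theta> j f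
    using orth_proj_eqI[OF w V fn.subspace_0[OF V]] that(2) projections[OF that(1)] by simp
  have lam_real: "cnj (lam \<theta> j) = lam \<theta> j" if "j \<in> {1..h \<theta>}" for \<theta> j
    using real_eigenvalue_M_op lam(2)[OF that] .
  have M_sym: "inner_on w (M_op E \<theta> f) g = inner_on w f (M_op E \<theta> g)" for \<theta> f g
    using decomposition[of \<theta>] lam_real
    by (rule symmetric_spectral_sum) (simp_all add: projections orth_proj_symmetric w V)
  have P_P: "P \<theta> j (P \<theta> i f) = 0" if "j \<in> {1..h \<theta>}" "i \<in> {1..h \<theta>}" "j \<noteq> i" for \<theta> j i f
  proof (rule P_eq_0[OF that(1)])
    fix u assume "u \<in> ?V \<theta> j"
    moreover have "lam \<theta> i \<noteq> lam \<theta> j"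
      using that inj_onD[OF lam_inj] by blast
    ultimately show "inner_on w (P \<theta> i f) u = 0"
      using eigenspaces_orthogonal_symmetric[OF M_sym] lam_real P_in that by blast
  qed

  have decomp: "?L = (\<lambda>\<Phi> p. \<Sum>\<theta>\<in>UNIV. \<Sum>j=1..h \<theta>. lam \<theta> j * ?T \<theta> j \<Phi> p)"
  proof (intro ext)
    fix \<Phi> p
    have "(chi \<theta> \<otimes> M_op E \<theta> (Q_op \<theta> \<Phi>)) p = (\<Sum>j=1..h \<theta>. lam \<theta> j * ?T \<theta> j \<Phi> p)" for \<theta>
      by (subst decomposition)
        (simp add: chi_tensor_op_def tensor_def case_prod_beta sum_distrib_left mult_ac)
    then show "?L \<Phi> p = (\<Sum>\<theta>\<in>UNIV. \<Sum>j=1..h \<theta>. lam \<theta> j * ?T \<theta> j \<Phi> p)"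
      by (simp add: lamplighter_Fourier)
  qed

  have proj: "?T \<theta> j = orth_proj (inner_on (w \<circ> snd)) ((\<otimes>) (chi \<theta>) ` ?V \<theta> j)"
    if "j \<in> {1..h \<theta>}" for \<theta> j
    unfolding projections[OF that] by (rule chi_tensor_op_orth_proj[OF w V])

  have disjoint: "?T \<theta> j \<circ> ?T \<sigma> i = 0"
    if "j \<in> {1..h \<theta>}" "i \<in> {1..h \<sigma>}" "(\<theta>, j) \<noteq> (\<sigma>, i)" for \<theta> \<sigma> j i
  proof
    fix \<Phi>
    \<comment> \<open>For distinct characters the inner coefficient is already 0, and
      \<open>P_eq_0\<close> at the zero function gives that \<open>P\<close> fixes 0. For equal
      characters the indices differ and \<open>P_P\<close> applies.\<close>
    have "P \<theta> j (Q_op \<theta> (chi \<sigma> \<otimes> P \<sigma> i (Q_op \<sigma> \<Phi>))) = 0"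
      using that P_P P_eq_0[OF that(1), of 0] by (auto simp: Q_op_tensor)
    then show "(?T \<theta> j \<circ> ?T \<sigma> i) \<Phi> = 0 \<Phi>"
      by (simp add: chi_tensor_op_def chi_tensor_eq_0_iff)
  qed

  have spec: "nonzero_eigenvalues ?L = {lam \<theta> j | \<theta> j. j \<in> {1..h \<theta>}}"
  proof (intro equalityI subsetI)
    fix c assume "c \<in> nonzero_eigenvalues ?L"
    then obtain \<Phi> where c: "c \<noteq> 0" "\<Phi> \<in> eigenspace ?L c" "\<Phi> \<noteq> 0"
      by (auto simp: nonzero_eigenvalues_def eigenvalue_def)
    \<comment> \<open>A nonzero Fourier coefficient of the eigenvector is an eigenvector of the
      corresponding \<open>M_op E \<theta>\<close>.\<close>
    have "\<exists>\<theta>. Q_op \<theta> \<Phi> \<noteq> 0"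
    proof (rule ccontr)
      assume "\<not> ?thesis"
      then have "\<Phi> = 0"
        using Fourier_inversion[of \<Phi>] by (simp add: tensor_def case_prod_beta fun_eq_iff)
      with c show False by simp
    qed
    then obtain \<theta> where "eigenvalue (M_op E \<theta>) c"
      using Q_op_eigenspace[OF c(2)] by (auto simp: eigenvalue_def)
    then show "c \<in> {lam \<theta> j | \<theta> j. j \<in> {1..h \<theta>}}"
      using lam_surj[OF c(1)] by blast
  next
    fix c assume "c \<in> {lam \<theta> j | \<theta> j. j \<in> {1..h \<theta>}}"
    then obtain \<theta> j where c: "c = lam \<theta> j" "j \<in> {1..h \<theta>}" by blast
    then obtain f where "f \<in> ?V \<theta> j" "f \<noteq> 0"
      using lam(2) by (auto simp: eigenvalue_def)
    then have "eigenvalue ?L c"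
      unfolding eigenvalue_def c(1) using chi_tensor_eigenspace chi_tensor_eq_0_iff by blast
    then show "c \<in> nonzero_eigenvalues ?L"
      using lam(1) c by (simp add: nonzero_eigenvalues_def)
  qed

  have spec_proj: "orth_proj (inner_on (w \<circ> snd)) (eigenspace ?L c)
      = (\<lambda>\<Phi> p. \<Sum>\<theta>\<in>UNIV. \<Sum>j | j \<in> {1..h \<theta>} \<and> lam \<theta> j = c. ?T \<theta> j \<Phi> p)"
    if c: "c \<in> nonzero_eigenvalues ?L" for c
  proof
    fix \<Phi> :: "('a \<Rightarrow> bit) \<times> 'a \<Rightarrow> complex"
    let ?J = "\<lambda>\<theta>. {j. j \<in> {1..h \<theta>} \<and> lam \<theta> j = c}"
    \<comment> \<open>By injectivity of \<open>lam \<theta>\<close>, \<open>?J \<theta>\<close> has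
      at most one element; \<open>g \<theta>\<close> is thus the projection of the coefficient onto
      the eigenspace of \<open>c\<close>, or 0 if \<open>c\<close> is no eigenvalue for this
      \<open>\<theta>\<close>.\<close>
    define g where "g \<theta> = (\<lambda>x. \<Sum>j\<in>?J \<theta>. P \<theta> j (Q_op \<theta> \<Phi>) x)" for \<theta>
    have T_eq: "(\<Sum>j\<in>?J \<theta>. ?T \<theta> j \<Phi> p) = (chi \<theta> \<otimes> g \<theta>) p" for \<theta> p
      by (simp add: g_def chi_tensor_op_def tensor_def case_prod_beta sum_distrib_left)
    have g_in: "g \<theta> \<in> eigenspace (M_op E \<theta>) c" for \<theta>
      unfolding g_def sum_fun_eq[symmetric]
      by (rule fn.subspace_sum[OF V]) (use P_in in auto)
    have g_orth: "inner_on w (Q_op \<theta> \<Phi> - g \<theta>) u = 0" if u: "u \<in> eigenspace (M_op E \<theta>) c" for \<theta> u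
    proof (cases "eigenvalue (M_op E \<theta>) c")
      case True
      then obtain j where j: "j \<in> {1..h \<theta>}" "c = lam \<theta> j"
        using lam_surj[OF _ True] c by (auto simp: nonzero_eigenvalues_def)
      then have "?J \<theta> = {j}"
        using inj_onD[OF lam_inj[of \<theta>]] by auto
      then have "g \<theta> = P \<theta> j (Q_op \<theta> \<Phi>)"
        by (simp add: g_def)
      then show ?thesis
        using P_orth j u by simp
    next
      case False
      then have "u = 0"
        using u by (auto simp: eigenvalue_def)
      then show ?thesis by simp
    qed
    have "orth_proj (inner_on (w \<circ> snd)) (eigenspace ?L c) \<Phi>
        = (\<lambda>p. \<Sum>\<theta>\<in>UNIV. (chi \<theta> \<otimes> g \<theta>) p)"
    proof (rule orth_proj_eqI[OF _ subspace_eigenspace_lamplighter])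
      show "(\<lambda>p. \<Sum>\<theta>\<in>UNIV. (chi \<theta> \<otimes> g \<theta>) p) \<in> eigenspace ?L c"
        unfolding sum_fun_eq[symmetric]
        by (intro fn.subspace_sum[OF subspace_eigenspace_lamplighter] chi_tensor_eigenspace g_in)
    next
      \<comment> \<open>Parseval splits the scalar product over the characters, and each coefficient
        of \<open>u\<close> lies in an eigenspace to which \<open>g_orth\<close> applies.\<close>
      fix u assume "u \<in> eigenspace ?L c"
      then show "inner_on (w \<circ> snd) (\<Phi> - (\<lambda>p. \<Sum>\<theta>\<in>UNIV. (chi \<theta> \<otimes> g \<theta>) p)) u = 0"
        by (simp add: Parseval Q_op_diff Q_op_sum_tensor g_orth Q_op_eigenspace)
    qed (simp add: w)
    then show "orth_proj (inner_on (w \<circ> snd)) (eigenspace ?L c) \<Phi>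
        = (\<lambda>p. \<Sum>\<theta>\<in>UNIV. \<Sum>j\<in>?J \<theta>. ?T \<theta> j \<Phi> p)"
      by (simp only: T_eq)
  qed

  have kernel: "?L (chi \<theta> \<otimes> f) = 0" if "\<forall>x\<in>zero_set \<theta>. f x = 0" for \<theta> f
  proof -
    \<comment> \<open>\<open>M_op\<close> reads \<open>f\<close> only at points of
      \<open>zero_set \<theta>\<close>.\<close>
    have "M_op E \<theta> f = 0"
      using that by (simp add: M_op_def fun_eq_iff)
    then show ?thesis
      by (simp only: lamplighter_chi_tensor chi_tensor_eq_0_iff)
  qed

  show ?thesis
  proof (intro conjI allI ballI impI)
    show "(\<otimes>) (chi \<theta>) ` ?V \<theta> j \<subseteq> eigenspace ?L (lam \<theta> j)" for \<theta> j
      using chi_tensor_eigenspace by blast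
  qed (rule decomp proj disjoint spec spec_proj kernel; assumption)+
qed

end
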